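(* Let $a>0$, $\omega\in\mathbb{R}\setminus\{0\}$, $k\in\mathbb{N}$, and let $c\in\mathbb{C}\setminus\{0\}$ satisfy $c^{k-1}=1$. Let $f\in C^2(\mathbb{R})$, $g\in C^1(\mathbb{R})$, $g^{[1]}(x):=\int_0^xg(s)\,ds$, and let $$u(x,t)=\frac12\bigl[f(x-at)+f(x+at)\bigr]+\frac1{2a}\int_{x-at}^{x+at}g(s)\,ds,\qquad (x,t)\in\mathbb{R}^2$$ (the d'Alembert formula for $u_{tt}=a^2u_{xx}$, $u(x,0)=f(x)$, $u_t(x,0)=g(x)$). Suppose that $\mathbb{D}\subseteq\mathbb{R}^2$ is an unbounded set such that $$\lim_{|(x,t)|\to+\infty,\,(x,t)\in\mathbb{D}}\Biggl[|f(x-at+\omega)-cf(x-at)|+\bigl|g^{[1]}(x-at+\omega)-cg^{[1]}(x-at)\bigr|$$ $$+\sum_{j=1}^k\Bigl(|f(x+at+j\omega)-cf(x+at+(j-1)\omega)|+\bigl|g^{[1]}(x+at+j\omega)-cg^{[1]}(x+at+(j-1)\omega)\bigr|\Bigr)\Biggr]=0.$$ Put $\omega_1:=\frac{1+k}2\omega$ and $\omega_2:=\frac{k-1}{2a}\omega$. Then $u$ is $(S,\mathbb{D})$-asymptotically $((\omega_1,\omega_2),c)$-periodic, i.e. $$\lim_{|(x,t)|\to+\infty,\,(x,t)\in\mathbb{D}}\bigl|u(x+\omega_1,t+\omega_2)-c\,u(x,t)\bigr|=0.$$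
   Context: $f,g$ are scalar-valued functions and $|\cdot|$ on $\mathbb{R}^2$ is the Euclidean norm. *)

theory Defs
  imports "HOL-Analysis.Analysis"
begin

definition C2_function :: "(real \<Rightarrow> 'a::real_normed_vector) \<Rightarrow> bool" where
  "C2_function f \<longleftrightarrow>
     (\<exists>f'. (\<forall>x. (f has_vector_derivative f' x) (at x)) \<and> f' C1_differentiable_on UNIV)"

text \<open>The interval integrals below are oriented: swapping the endpoints changes the sign.\<close>

definition primitive0 :: "(real \<Rightarrow> complex) \<Rightarrow> real \<Rightarrow> complex" where
  "primitive0 g x = (LBINT s=ereal 0..ereal x. g s)"

definition dAlembert :: "real \<Rightarrow> (real \<Rightarrow> complex) \<Rightarrow> (real \<Rightarrow> complex) \<Rightarrow> real \<times> real \<Rightarrow> complex" where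
  "dAlembert a f g = (\<lambda>(x, t).
     (1 / 2) * (f (x - a * t) + f (x + a * t))
     + (1 / (2 * complex_of_real a)) * (LBINT s=ereal (x - a * t)..ereal (x + a * t). g s))"

definition at_infinity_in :: "'a::real_normed_vector set \<Rightarrow> 'a filter" where
  "at_infinity_in D = inf at_infinity (principal D)"

definition S_asymptotically_periodic ::
    "'a::real_normed_vector set \<Rightarrow> 'a \<Rightarrow> complex \<Rightarrow> ('a \<Rightarrow> complex) \<Rightarrow> bool" where
  "S_asymptotically_periodic D w c F \<longleftrightarrow>
     ((\<lambda>p. norm (F (p + w) - c * F p)) \<longlongrightarrow> 0) (at_infinity_in D)"

end

theory Submission
  imports Defs
begin

text \<open>
  In the characteristic variables \<open>y = x - a t\<close> and \<open>z = x + a t\<close>, the shift by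
  \<open>(\<omega>\<^sub>1, \<omega>\<^sub>2)\<close> becomes \<open>(y, z) \<mapsto> (y + \<omega>, z + k \<omega>)\<close>. The first component is
  controlled directly; for the second, the \<open>k\<close> steps are telescoped with weights
  \<open>c ^ (k - j)\<close>, using \<open>c ^ k = c\<close>; the weights have modulus one.
\<close>

lemma norm_telescope_le:
  fixes h :: "nat \<Rightarrow> 'a::real_normed_div_algebra"
  assumes "norm c \<le> 1"
  shows "norm (h k - c ^ k * h 0) \<le> (\<Sum>j = 1..k. norm (h j - c * h (j - 1)))"
proof (induction k)
  case 0
  then show ?case by simp
next
  case (Suc k)
  have "norm (h (Suc k) - c ^ Suc k * h 0)
      = norm ((h (Suc k) - c * h k) + c * (h k - c ^ k * h 0))"
    by (simp add: algebra_simps)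
  also have "\<dots> \<le> norm (h (Suc k) - c * h k) + norm c * norm (h k - c ^ k * h 0)"
    by (metis norm_mult norm_triangle_ineq)
  also have "\<dots> \<le> norm (h (Suc k) - c * h k) + norm (h k - c ^ k * h 0)"
    using assms by (simp add: mult_left_le_one_le)
  finally show ?case using Suc.IH by simp
qed

text \<open>For \<open>k = 1\<close> the modulus of \<open>c\<close> may be arbitrary, but the sum
  is then the single term on the left. For larger \<open>k\<close>, \<open>c\<close> is a root of
  unity, so it has modulus one and telescoping along \<open>z\<close>, \<open>z + \<omega>\<close>,
  ..., \<open>z + k \<omega>\<close> applies.\<close>

lemma norm_shift_telescope_le:
  fixes h :: "real \<Rightarrow> complex"
  assumes "k \<ge> 1" and "c ^ (k - 1) = 1"
  shows "norm (h (z + real k * \<omega>) - c * h z)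
    \<le> (\<Sum>j = 1..k. norm (h (z + real j * \<omega>) - c * h (z + (real j - 1) * \<omega>)))"
proof (cases "k = 1")
  case True
  then show ?thesis by simp
next
  case False
  have "norm c ^ (k - 1) = 1"
    using assms(2) by (metis norm_one norm_power)
  with False assms(1) have "norm c = 1"
    by (metis diff_is_0_eq le_antisym norm_ge_zero power_eq_1_iff abs_of_nonneg real_norm_def)
  moreover have "c ^ k = c"
    using assms by (metis Suc_diff_1 less_le_trans mult.right_neutral power_Suc zero_less_one)
  ultimately have "norm (h (z + real k * \<omega>) - c * h z)
      \<le> (\<Sum>j = 1..k. norm (h (z + real j * \<omega>) - c * h (z + real (j - 1) * \<omega>)))"
    using norm_telescope_le[of c "\<lambda>j. h (z + real j * \<omega>)" k] by simp
  \<comment> \<open>Truncated and real subtraction agree here because the sum starts at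
    \<open>j = 1\<close>.\<close>
  also have "\<dots> = (\<Sum>j = 1..k. norm (h (z + real j * \<omega>) - c * h (z + (real j - 1) * \<omega>)))"
    by (intro sum.cong refl) (simp add: of_nat_diff)
  finally show ?thesis .
qed

lemma LBINT_eq_primitive0_diff:
  assumes "continuous_on UNIV g"
  shows "(LBINT s=ereal y..ereal z. g s) = primitive0 g z - primitive0 g y"
proof -
  have integrable: "interval_lebesgue_integrable lborel (ereal u) (ereal v) g" for u v
    using assms
    by (auto intro!: interval_integrable_continuous_on interval_integrable_isCont
        simp: continuous_on_eq_continuous_at)
  \<comment> \<open>Additivity over \<open>0\<close>, \<open>y\<close>, \<open>z\<close> in any
    order requires integrability on their hull. No order may be assumed: \<open>x - a t\<close>
    exceeds \<open>x + a t\<close> when \<open>t < 0\<close>.\<close>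
  have "interval_lebesgue_integrable lborel (min (ereal 0) (min (ereal y) (ereal z)))
      (max (ereal 0) (max (ereal y) (ereal z))) g"
    using integrable by (simp flip: ereal_min ereal_max)
  from interval_integral_sum[OF this] show ?thesis
    unfolding primitive0_def by (metis add_diff_cancel_left')
qed

text \<open>A pointwise estimate that reduces the theorem to a comparison of limits: the constant
  adds the weights of the \<open>f\<close> part and the \<open>g\<close> part in the d'Alembert
  formula and does not depend on \<open>(x, t)\<close>.\<close>

lemma dAlembert_shift_diff_le:
  assumes "a > 0" and "k \<ge> 1" and "c ^ (k - 1) = 1" and "continuous_on UNIV g"
    and \<omega>\<^sub>1: "\<omega>\<^sub>1 = (1 + real k) / 2 * \<omega>"
    and \<omega>\<^sub>2: "\<omega>\<^sub>2 = (real k - 1) / (2 * a) * \<omega>"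
  shows "norm (dAlembert a f g (x + \<omega>\<^sub>1, t + \<omega>\<^sub>2) - c * dAlembert a f g (x, t))
    \<le> (1 / 2 + 1 / (2 * a)) *
      (norm (f (x - a * t + \<omega>) - c * f (x - a * t))
       + norm (primitive0 g (x - a * t + \<omega>) - c * primitive0 g (x - a * t))
       + (\<Sum>j = 1..k.
           norm (f (x + a * t + real j * \<omega>) - c * f (x + a * t + (real j - 1) * \<omega>))
           + norm (primitive0 g (x + a * t + real j * \<omega>)
                   - c * primitive0 g (x + a * t + (real j - 1) * \<omega>))))"
proof -
  define y z where "y = x - a * t" and "z = x + a * t"
  define G where "G = primitive0 g"
  \<comment> \<open>The two shifts solve
    \<open>\<omega>\<^sub>1 - a \<omega>\<^sub>2 = \<omega>\<close> and
    \<open>\<omega>\<^sub>1 + a \<omega>\<^sub>2 = k \<omega>\<close>.\<close>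
  have "a * \<omega>\<^sub>2 = (real k - 1) / 2 * \<omega>"
    using \<open>a > 0\<close> by (simp add: \<omega>\<^sub>2)
  then have y: "x + \<omega>\<^sub>1 - a * (t + \<omega>\<^sub>2) = y + \<omega>"
    and z: "x + \<omega>\<^sub>1 + a * (t + \<omega>\<^sub>2) = z + real k * \<omega>"
    by (simp_all add: y_def z_def \<omega>\<^sub>1 field_simps)
  let ?f\<^sub>y = "f (y + \<omega>) - c * f y" and ?f\<^sub>z = "f (z + real k * \<omega>) - c * f z"
  let ?G\<^sub>y = "G (y + \<omega>) - c * G y" and ?G\<^sub>z = "G (z + real k * \<omega>) - c * G z"
  define F where "F = (\<Sum>j = 1..k. norm (f (z + real j * \<omega>) - c * f (z + (real j - 1) * \<omega>)))"
  define H where "H = (\<Sum>j = 1..k. norm (G (z + real j * \<omega>) - c * G (z + (real j - 1) * \<omega>)))"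
  have F: "norm ?f\<^sub>z \<le> F" and H: "norm ?G\<^sub>z \<le> H"
    unfolding F_def H_def by (intro norm_shift_telescope_le assms)+
  \<comment> \<open>Writing the integral as \<open>G z - G y\<close> separates the two
    characteristic variables.\<close>
  have "dAlembert a f g (x + \<omega>\<^sub>1, t + \<omega>\<^sub>2) - c * dAlembert a f g (x, t)
      = (1 / 2) * (?f\<^sub>y + ?f\<^sub>z) + (1 / (2 * complex_of_real a)) * (?G\<^sub>z - ?G\<^sub>y)"
    unfolding dAlembert_def prod.case y z LBINT_eq_primitive0_diff[OF assms(4)]
      y_def[symmetric] z_def[symmetric] G_def[symmetric]
    by (simp add: algebra_simps diff_divide_distrib add_divide_distrib)
  also have "norm \<dots> \<le> norm ((1 / 2) * (?f\<^sub>y + ?f\<^sub>z))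
      + norm ((1 / (2 * complex_of_real a)) * (?G\<^sub>z - ?G\<^sub>y))"
    by (rule norm_triangle_ineq)
  also have "\<dots> = 1 / 2 * norm (?f\<^sub>y + ?f\<^sub>z) + 1 / (2 * a) * norm (?G\<^sub>z - ?G\<^sub>y)"
    using \<open>a > 0\<close> by (simp add: norm_mult norm_divide)
  also have "\<dots> \<le> 1 / 2 * (norm ?f\<^sub>y + F) + 1 / (2 * a) * (norm ?G\<^sub>y + H)"
    using \<open>a > 0\<close> F H norm_triangle_ineq[of ?f\<^sub>y ?f\<^sub>z] norm_triangle_ineq4[of ?G\<^sub>z ?G\<^sub>y]
    by (intro add_mono mult_left_mono) auto
  \<comment> \<open>Each bracket is at most the full sum, as all summands are nonnegative, so the
    two weights add up.\<close>
  also have "\<dots> \<le> (1 / 2 + 1 / (2 * a)) * (norm ?f\<^sub>y + norm ?G\<^sub>y + (F + H))"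
  proof -
    have "0 \<le> F" "0 \<le> H"
      unfolding F_def H_def by (simp_all add: sum_nonneg)
    then have "1 / 2 * (norm ?f\<^sub>y + F) \<le> 1 / 2 * (norm ?f\<^sub>y + norm ?G\<^sub>y + (F + H))"
      and "1 / (2 * a) * (norm ?G\<^sub>y + H) \<le> 1 / (2 * a) * (norm ?f\<^sub>y + norm ?G\<^sub>y + (F + H))"
      using \<open>a > 0\<close> by (intro mult_left_mono; simp)+
    then show ?thesis by (simp only: distrib_right)
  qed
  finally show ?thesis
    by (simp add: F_def H_def G_def y_def z_def sum.distrib)
qed

theorem mainTheorem13:
  fixes a \<omega> \<omega>\<^sub>1 \<omega>\<^sub>2 :: real and k :: nat and c :: complex
    and f g :: "real \<Rightarrow> complex" and D :: "(real \<times> real) set"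
  assumes "a > 0" and "\<omega> \<noteq> 0" and "k \<ge> 1" and "c \<noteq> 0" and "c ^ (k - 1) = 1"
    and "C2_function f" and "g C1_differentiable_on UNIV"
    and "\<not> bounded D"
    and "((\<lambda>(x, t).
            norm (f (x - a * t + \<omega>) - c * f (x - a * t))
            + norm (primitive0 g (x - a * t + \<omega>) - c * primitive0 g (x - a * t))
            + (\<Sum>j = 1..k.
                norm (f (x + a * t + real j * \<omega>) - c * f (x + a * t + (real j - 1) * \<omega>))
                + norm (primitive0 g (x + a * t + real j * \<omega>)
                        - c * primitive0 g (x + a * t + (real j - 1) * \<omega>))))
          \<longlongrightarrow> 0) (at_infinity_in D)"
    and "\<omega>\<^sub>1 = (1 + real k) / 2 * \<omega>"
    and "\<omega>\<^sub>2 = (real k - 1) / (2 * a) * \<omega>"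
  shows "S_asymptotically_periodic D (\<omega>\<^sub>1, \<omega>\<^sub>2) c (dAlembert a f g)"
proof -
  have "continuous_on UNIV g"
    using assms(7) by (rule C1_differentiable_imp_continuous_on)
  note bound = dAlembert_shift_diff_le[OF assms(1,3,5) this assms(10,11)]
  \<comment> \<open>The bound holds at every point, hence eventually along the filter, and a fixed
    multiple of a null function is null.\<close>
  show ?thesis
    unfolding S_asymptotically_periodic_def
    by (rule Lim_null_comparison[OF _ tendsto_mult_right_zero[OF assms(9), of "1 / 2 + 1 / (2 * a)"]])
      (use bound in \<open>auto intro!: always_eventually\<close>)
qed

end
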